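(* Let $X\subseteq\mathbb{R}^n$ and $Y\subseteq\mathbb{R}^m$ be convex, closed and nonempty sets, let $f,g_1,\dots,g_p:\mathbb{R}^m\times\mathbb{R}^n\to\,]-\infty,+\infty]$ be proper, lower semicontinuous, convex (possibly nondifferentiable), $g=(g_1,\dots,g_p)$, let $A,B$ be matrices and $b$ a vector of compatible sizes, and let $\bar x\in X$. Consider $$\mathcal{Q}(x)=\min_{y}\{f(y,x): g(y,x)\le0,\ Ay+Bx=b,\ y\in Y\},$$ the set $S=\{(y,z)\in\mathbb{R}^m\times\mathbb{R}^n: g(y,z)\le0,\ Ay+Bz=b,\ y\in Y\}$, and the dual problem $$\max_{\lambda\in\mathbb{R}^n}\theta_x(\lambda),\qquad \theta_x(\lambda)=\min\{f(y,z)+\langle\lambda,x-z\rangle:(y,z)\in S\}.$$ Assume that $f(\cdot,\bar x)$ is finite on $\{y\in Y: Ay+B\bar x=b,\ g(y,\bar x)\le0\}$ and that there exists $y_{\bar x}$ such that $(y_{\bar x},\bar x)\in\mathrm{ri}(S)$. Let $\hat y$ be any approximate optimal and feasible solution of the primal problem defining $\mathcal{Q}(\bar x)$ and let $\hat\lambda$ be any approximate optimal feasible solution of the dual problem written for $x=\bar x$. Then $$\mathcal{C}(x)=\theta_{\bar x}(\hat\lambda)+\langle\hat\lambda,x-\bar x\rangle$$ is an $(f(\hat y,\bar x)-\theta_{\bar x}(\hat\lambda))$-inexact cut for $\mathcal{Q}$ at $\bar x$. When $\hat y$ and $\hat\lambda$ are optimal solutions, it is an exact cut, since then $f(\hat y,\bar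 x)=\theta_{\bar x}(\hat\lambda)=\mathcal{Q}(\bar x)$.
   Context: Definition ($\varepsilon$-inexact cut). Let $\mathcal{Q}:X\to\mathbb{R}$ be a convex function with $X\subset\mathbb{R}^n$ convex, $X\subset\mathrm{ri}(\mathrm{dom}(\mathcal{Q}))$, and let $\varepsilon\ge0$. A function $\mathcal{C}:X\to\mathbb{R}$ is an $\varepsilon$-inexact cut for $\mathcal{Q}$ at $\bar x\in X$ if $\mathcal{C}$ is affine, $\mathcal{Q}(x)\ge\mathcal{C}(x)$ for all $x\in X$, and $\mathcal{Q}(\bar x)-\mathcal{C}(\bar x)\le\varepsilon$. A $0$-inexact cut is called an exact cut. $\mathrm{ri}$ denotes relative interior. $\min$ and $\max$ denote optimal values (infimum/supremum). "Approximate optimal feasible solution" means a feasible point which is $\varepsilon$-optimal for some finite $\varepsilon\ge0$, i.e. whose objective value is within $\varepsilon$ of the optimal value.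
   Formalization: The full inexact-cut claim and the exactness claim are stated under the requirement X ⊂ ri(dom Q) from the definition of a cut, without which f(ŷ,x̄)=θ(λ̂)=Q(x̄) can fail; affinity, minorization on X and the gap bound are stated without it. *)

theory Defs
  imports "HOL-Analysis.Analysis"
begin

section \<open>Extended-real-valued functions\<close>

(* For functions that avoid -\<infinity>, and with the ereal conventions 0 * \<infinity> = 0 and
   \<infinity> + (-\<infinity>) = \<infinity>, this is convexity of the epigraph. *)
definition ereal_convex_on :: "'a::real_vector set \<Rightarrow> ('a \<Rightarrow> ereal) \<Rightarrow> bool" where
  "ereal_convex_on X f \<longleftrightarrow> convex X \<and>
     (\<forall>u\<in>X. \<forall>v\<in>X. \<forall>t::real. 0 \<le> t \<and> t \<le> 1 \<longrightarrow>
        f ((1 - t) *\<^sub>R u + t *\<^sub>R v) \<le> ereal (1 - t) * f u + ereal t * f v)"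

definition ereal_proper :: "('a \<Rightarrow> ereal) \<Rightarrow> bool" where
  "ereal_proper f \<longleftrightarrow> (\<forall>u. f u \<noteq> -\<infinity>) \<and> (\<exists>u. f u \<noteq> \<infinity>)"

definition ereal_lsc :: "('a::topological_space \<Rightarrow> ereal) \<Rightarrow> bool" where
  "ereal_lsc f \<longleftrightarrow> (\<forall>u. f u \<le> Liminf (at u) f)"

definition ereal_dom :: "('a \<Rightarrow> ereal) \<Rightarrow> 'a set" where
  "ereal_dom f = {u. f u < \<infinity>}"

section \<open>Inexact cuts\<close>

definition affine_fun_on :: "'a::real_vector set \<Rightarrow> ('a \<Rightarrow> real) \<Rightarrow> bool" where
  "affine_fun_on X C \<longleftrightarrow> (\<exists>h c. linear h \<and> (\<forall>x\<in>X. C x = h x + c))"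

(* The setting in which cuts are defined: Q is a real-valued convex function on the convex
   set X, and X lies in ri (dom Q).  A function with values in the extended reals is used
   because dom Q is the domain of Q as a function on the whole space (for the value function
   below: the parameters x, inside or outside X, with Q x < \<infinity>), not of its restriction to X. *)
definition cut_setting :: "'a::euclidean_space set \<Rightarrow> ('a \<Rightarrow> ereal) \<Rightarrow> bool" where
  "cut_setting X Q \<longleftrightarrow> convex X \<and> (\<forall>x\<in>X. \<bar>Q x\<bar> \<noteq> \<infinity>) \<and> ereal_convex_on X Q \<and>
     X \<subseteq> rel_interior (ereal_dom Q)"

(* The requirements imposed on the cut C itself; they make sense for any Q. *)
definition cut_conditions ::
  "'a::euclidean_space set \<Rightarrow> ('a \<Rightarrow> ereal) \<Rightarrow> ('a \<Rightarrow> real) \<Rightarrow> 'a \<Rightarrow> real \<Rightarrow> bool" where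
  "cut_conditions X Q C xbar \<epsilon> \<longleftrightarrow> 0 \<le> \<epsilon> \<and> xbar \<in> X \<and> affine_fun_on X C \<and>
     (\<forall>x\<in>X. Q x \<ge> ereal (C x)) \<and> Q xbar - ereal (C xbar) \<le> ereal \<epsilon>"

definition inexact_cut ::
  "'a::euclidean_space set \<Rightarrow> ('a \<Rightarrow> ereal) \<Rightarrow> ('a \<Rightarrow> real) \<Rightarrow> 'a \<Rightarrow> real \<Rightarrow> bool" where
  "inexact_cut X Q C xbar \<epsilon> \<longleftrightarrow> cut_setting X Q \<and> cut_conditions X Q C xbar \<epsilon>"

definition exact_cut ::
  "'a::euclidean_space set \<Rightarrow> ('a \<Rightarrow> ereal) \<Rightarrow> ('a \<Rightarrow> real) \<Rightarrow> 'a \<Rightarrow> bool" where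
  "exact_cut X Q C xbar \<longleftrightarrow> inexact_cut X Q C xbar 0"

section \<open>The parametric primal problem and its dual\<close>

definition constraint_set ::
  "(real^'m) set \<Rightarrow> nat \<Rightarrow> (nat \<Rightarrow> (real^'m) \<times> (real^'n) \<Rightarrow> ereal) \<Rightarrow>
   real^'m^'q \<Rightarrow> real^'n^'q \<Rightarrow> real^'q \<Rightarrow> ((real^'m) \<times> (real^'n)) set" where
  "constraint_set Y p g A B b =
     {(y, z). (\<forall>i\<in>{1..p}. g i (y, z) \<le> 0) \<and> A *v y + B *v z = b \<and> y \<in> Y}"

definition value_fun ::
  "('m \<times> 'n \<Rightarrow> ereal) \<Rightarrow> ('m \<times> 'n) set \<Rightarrow> 'n \<Rightarrow> ereal" where
  "value_fun f S x = (INF y\<in>{y. (y, x) \<in> S}. f (y, x))"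

definition dual_fun ::
  "('m \<times> 'n::real_inner \<Rightarrow> ereal) \<Rightarrow> ('m \<times> 'n) set \<Rightarrow> 'n \<Rightarrow> 'n \<Rightarrow> ereal" where
  "dual_fun f S x lam = (INF (y, z)\<in>S. f (y, z) + ereal (lam \<bullet> (x - z)))"

definition dual_value ::
  "('m \<times> 'n::real_inner \<Rightarrow> ereal) \<Rightarrow> ('m \<times> 'n) set \<Rightarrow> 'n \<Rightarrow> ereal" where
  "dual_value f S x = (SUP lam. dual_fun f S x lam)"

(* An objective value v within some finite distance of the optimal value.  Since
   \<bar>\<infinity> - \<infinity>\<bar> = \<bar>(-\<infinity>) - (-\<infinity>)\<bar> = \<infinity> in ereal, this forces both v and opt to be finite. *)
definition approx_value :: "ereal \<Rightarrow> ereal \<Rightarrow> bool" where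
  "approx_value v opt \<longleftrightarrow> (\<exists>\<epsilon>::real. 0 \<le> \<epsilon> \<and> \<bar>v - opt\<bar> \<le> ereal \<epsilon>)"

definition approx_primal_sol ::
  "('m \<times> 'n \<Rightarrow> ereal) \<Rightarrow> ('m \<times> 'n) set \<Rightarrow> 'n \<Rightarrow> 'm \<Rightarrow> bool" where
  "approx_primal_sol f S x y \<longleftrightarrow> (y, x) \<in> S \<and> approx_value (f (y, x)) (value_fun f S x)"

definition approx_dual_sol ::
  "('m \<times> 'n::real_inner \<Rightarrow> ereal) \<Rightarrow> ('m \<times> 'n) set \<Rightarrow> 'n \<Rightarrow> 'n \<Rightarrow> bool" where
  "approx_dual_sol f S x lam \<longleftrightarrow> approx_value (dual_fun f S x lam) (dual_value f S x)"

definition optimal_primal_sol ::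
  "('m \<times> 'n \<Rightarrow> ereal) \<Rightarrow> ('m \<times> 'n) set \<Rightarrow> 'n \<Rightarrow> 'm \<Rightarrow> bool" where
  "optimal_primal_sol f S x y \<longleftrightarrow> (y, x) \<in> S \<and> f (y, x) = value_fun f S x"

definition optimal_dual_sol ::
  "('m \<times> 'n::real_inner \<Rightarrow> ereal) \<Rightarrow> ('m \<times> 'n) set \<Rightarrow> 'n \<Rightarrow> 'n \<Rightarrow> bool" where
  "optimal_dual_sol f S x lam \<longleftrightarrow> dual_fun f S x lam = dual_value f S x"

(* real_of_ereal is harmless here: the dual value at an approximate dual solution is finite. *)
definition dual_cut ::
  "('m \<times> 'n::real_inner \<Rightarrow> ereal) \<Rightarrow> ('m \<times> 'n) set \<Rightarrow> 'n \<Rightarrow> 'n \<Rightarrow> 'n \<Rightarrow> real" where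
  "dual_cut f S xbar lam x = real_of_ereal (dual_fun f S xbar lam) + lam \<bullet> (x - xbar)"

end

theory Submission
  imports Defs
begin

text \<open>
  Fix \<open>x\<^sub>0\<close> and a multiplier \<open>\<lambda>\<close>.  Restricting the infimum that defines the dual function to the
  points \<open>(y, x)\<close> of \<open>S\<close> with \<open>x\<close> prescribed gives
  \<open>\<theta>(\<lambda>) \<le> Q x + \<langle>\<lambda>, x\<^sub>0 - x\<rangle>\<close> for every \<open>x\<close> (\<open>dual_fun_minorant\<close>).  This one inequality says that
  the affine function in question lies below \<open>Q\<close> everywhere, and at \<open>x\<^sub>0\<close> it is weak duality, so
  that the gap \<open>f (y, x\<^sub>0) - \<theta>(\<lambda>)\<close> bounds the error of the cut at \<open>x\<^sub>0\<close>.  It also keeps \<open>Q\<close> away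
  from \<open>-\<infinity>\<close>, so \<open>Q\<close> is real-valued on the part of \<open>X\<close> inside its domain.  The convexity of \<open>S\<close>
  and \<open>f\<close> makes \<open>Q\<close> a convex function on the whole space (\<open>ereal_convex_on_value_fun\<close>).

  Exactness at optimal solutions is strong duality.  The dual function attains \<open>Q x\<^sub>0\<close> precisely at
  the subgradients of \<open>Q\<close> at \<open>x\<^sub>0\<close>.  When \<open>x\<^sub>0\<close> lies in the relative interior of the domain
  of \<open>Q\<close>, as it does under \<open>X \<subseteq> ri (dom Q)\<close>, a subgradient exists: it is the slope of a
  hyperplane supporting the epigraph of \<open>Q\<close> at \<open>(x\<^sub>0, Q x\<^sub>0)\<close>, which can be chosen non-vertical
  (\<open>ereal_convex_subgradient_exists\<close>).
\<close>

section \<open>Subgradients of extended-real-valued convex functions\<close>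

lemma ereal_convex_on_subset:
  "ereal_convex_on T Q \<Longrightarrow> X \<subseteq> T \<Longrightarrow> convex X \<Longrightarrow> ereal_convex_on X Q"
  unfolding ereal_convex_on_def by blast

lemma convex_ereal_epigraph:
  fixes Q :: "'a::real_vector \<Rightarrow> ereal"
  assumes "ereal_convex_on UNIV Q"
  shows "convex {(x, r). Q x \<le> ereal r}"
  unfolding convex_alt
proof (clarsimp)
  fix x r y s and t :: real
  assume le: "Q x \<le> ereal r" "Q y \<le> ereal s" and t: "0 \<le> t" "t \<le> 1"
  have "Q ((1 - t) *\<^sub>R x + t *\<^sub>R y) \<le> ereal (1 - t) * Q x + ereal t * Q y"
    using assms t unfolding ereal_convex_on_def by blast
  also have "\<dots> \<le> ereal (1 - t) * ereal r + ereal t * ereal s"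
    using le t by (intro add_mono ereal_mult_left_mono) auto
  finally show "Q ((1 - t) *\<^sub>R x + t *\<^sub>R y) \<le> ereal ((1 - t) * r + t * s)"
    by simp
qed

lemma ereal_dom_eq_fst_epigraph:
  fixes Q :: "'a \<Rightarrow> ereal"
  shows "ereal_dom Q = fst ` {(x, r). Q x \<le> ereal r}"
proof -
  have "(Q x < \<infinity>) \<longleftrightarrow> (\<exists>r. Q x \<le> ereal r)" for x
    by (cases "Q x") auto
  then show ?thesis
    unfolding ereal_dom_def by force
qed

text \<open>
  The graph point \<open>(x, Q x)\<close> is a relative boundary point of the epigraph, so the epigraph has a
  supporting hyperplane there that does not contain the relative interior of the epigraph.
  Relative interiors commute with linear images; hence \<open>x\<close>, being in the relative interior of the
  domain, lies under some relative interior point \<open>(x, r)\<close> of the epigraph.  Strict separation from that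
  point forces a positive last component of the normal, and dividing by it gives the subgradient.
\<close>

lemma ereal_convex_subgradient_exists:
  fixes Q :: "'a::euclidean_space \<Rightarrow> ereal"
  assumes cvx: "ereal_convex_on UNIV Q"
    and x: "x \<in> rel_interior (ereal_dom Q)"
    and fin: "\<bar>Q x\<bar> \<noteq> \<infinity>"
  obtains v where "\<And>z. Q x + ereal (v \<bullet> (z - x)) \<le> Q z"
proof -
  define E where "E = {(x, r). Q x \<le> ereal r}"
  have E: "convex E"
    unfolding E_def by (rule convex_ereal_epigraph[OF cvx])
  from fin obtain q where q: "Q x = ereal q" by auto
  have graph_in: "(x, q) \<in> E"
    by (simp add: E_def q)
  have graph_not_interior: "(x, q) \<notin> rel_interior E"
  proof
    assume "(x, q) \<in> rel_interior E"
    moreover have "E \<noteq> {}"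
      using graph_in by blast
    moreover have "(x, q + 1) \<in> E"
      by (simp add: E_def q)
    \<comment> \<open>prolonging the segment from \<open>(x, q + 1)\<close> beyond \<open>(x, q)\<close> would leave the epigraph downwards\<close>
    ultimately obtain e where e: "e > 1" "(1 - e) *\<^sub>R (x, q + 1) + e *\<^sub>R (x, q) \<in> E"
      using convex_rel_interior_iff[OF E] by blast
    have "(1 - e) *\<^sub>R (x, q + 1) + e *\<^sub>R (x, q) = (x, q + (1 - e))"
      by (simp add: algebra_simps)
    with e show False by (simp add: E_def q)
  qed
  obtain n where n: "\<And>w. w \<in> E \<Longrightarrow> n \<bullet> (x, q) \<le> n \<bullet> w"
    "\<And>w. w \<in> rel_interior E \<Longrightarrow> n \<bullet> (x, q) < n \<bullet> w"
    using supporting_hyperplane_rel_boundary[OF E graph_in graph_not_interior] by metis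
  obtain a \<alpha> where a: "n = (a, \<alpha>)" by (cases n)
  have "rel_interior (ereal_dom Q) = fst ` rel_interior E"
    unfolding ereal_dom_eq_fst_epigraph E_def[symmetric]
    by (rule rel_interior_convex_linear_image[OF _ E, symmetric]) (rule linear_fst)
  with x obtain r where r: "(x, r) \<in> rel_interior E" by auto
  then have "q \<le> r"
    using rel_interior_subset[of E] by (auto simp: E_def q)
  moreover have "\<alpha> * q < \<alpha> * r"
    using n(2)[OF r] by (simp add: a)
  ultimately have \<alpha>: "\<alpha> > 0"
    by (metis linorder_not_le mult_left_mono_neg)
  show thesis
  proof (rule that[of "- (a /\<^sub>R \<alpha>)"])
    fix z
    have real_bound: "q + (- (a /\<^sub>R \<alpha>)) \<bullet> (z - x) \<le> s" if "Q z \<le> ereal s" for s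
    proof -
      have "a \<bullet> x + \<alpha> * q \<le> a \<bullet> z + \<alpha> * s"
        using n(1)[of "(z, s)"] that by (simp add: E_def a)
      then show ?thesis
        using \<alpha> by (simp add: field_simps inner_diff_right)
    qed
    show "Q x + ereal ((- (a /\<^sub>R \<alpha>)) \<bullet> (z - x)) \<le> Q z"
      unfolding q plus_ereal.simps(1)
      by (rule ereal_le_real) (use real_bound in auto)
  qed
qed

section \<open>The value function and its dual\<close>

lemma convex_constraint_set:
  assumes Y: "convex Y"
    and g: "\<And>i. i \<in> {1..p} \<Longrightarrow> ereal_convex_on UNIV (g i)"
  shows "convex (constraint_set Y p g A B b)"
  unfolding convex_alt
proof (intro ballI allI impI)
  fix u v and t :: real
  assume u: "u \<in> constraint_set Y p g A B b" and v: "v \<in> constraint_set Y p g A B b"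
    and t: "0 \<le> t \<and> t \<le> 1"
  obtain y z y' z' where uv: "u = (y, z)" "v = (y', z')" by (cases u, cases v)
  have "g i ((1 - t) *\<^sub>R u + t *\<^sub>R v) \<le> 0" if i: "i \<in> {1..p}" for i
  proof -
    have "g i ((1 - t) *\<^sub>R u + t *\<^sub>R v) \<le> ereal (1 - t) * g i u + ereal t * g i v"
      using g[OF i] t unfolding ereal_convex_on_def by blast
    also have "\<dots> \<le> ereal (1 - t) * 0 + ereal t * 0"
      using u v t i by (intro add_mono ereal_mult_left_mono) (auto simp: constraint_set_def uv)
    finally show ?thesis by simp
  qed
  moreover have "A *v ((1 - t) *\<^sub>R y + t *\<^sub>R y') + B *v ((1 - t) *\<^sub>R z + t *\<^sub>R z') = b"
  proof -
    have "A *v ((1 - t) *\<^sub>R y + t *\<^sub>R y') + B *v ((1 - t) *\<^sub>R z + t *\<^sub>R z')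
        = (1 - t) *\<^sub>R (A *v y + B *v z) + t *\<^sub>R (A *v y' + B *v z')"
      by (simp add: matrix_vector_right_distrib matrix_vector_mult_scaleR scaleR_add_right)
    also have "\<dots> = b"
      using u v by (simp add: constraint_set_def uv flip: scaleR_add_left)
    finally show ?thesis .
  qed
  moreover have "(1 - t) *\<^sub>R y + t *\<^sub>R y' \<in> Y"
    using Y u v t unfolding convex_alt by (auto simp: constraint_set_def uv)
  ultimately show "(1 - t) *\<^sub>R u + t *\<^sub>R v \<in> constraint_set Y p g A B b"
    by (simp add: constraint_set_def uv)
qed

text \<open>
  Approximating \<open>a\<close> and \<open>b\<close> by reals from above also covers infima equal to \<open>-\<infinity>\<close>, where there
  are no minimizers up to a prescribed \<open>\<epsilon>\<close>.
\<close>

lemma ereal_le_convex_combinationI: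
  fixes a b x :: ereal and t :: real
  assumes "a \<noteq> \<infinity>" "b \<noteq> \<infinity>" and t: "0 < t" "t < 1"
    and le: "\<And>r s. a < ereal r \<Longrightarrow> b < ereal s \<Longrightarrow> x \<le> ereal ((1 - t) * r + t * s)"
  shows "x \<le> ereal (1 - t) * a + ereal t * b"
proof (rule dense_ge)
  fix z assume z: "ereal (1 - t) * a + ereal t * b < z"
  show "x \<le> z"
  proof (cases z)
    case (real w)
    have "\<exists>r s. a < ereal r \<and> b < ereal s \<and> (1 - t) * r + t * s = w"
    proof (cases a)
      case a: (real a')
      show ?thesis
      proof (cases b)
        case b: (real b')
        let ?d = "w - ((1 - t) * a' + t * b')"
        show ?thesis
          by (rule exI[of _ "a' + ?d"], rule exI[of _ "b' + ?d"])
            (use z in \<open>simp add: a b real algebra_simps\<close>)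
      next
        case MInf
        show ?thesis
          by (rule exI[of _ "a' + 1"], rule exI[of _ "(w - (1 - t) * (a' + 1)) / t"])
            (use t in \<open>simp add: a MInf\<close>)
      qed (use assms in simp)
    next
      case MInf
      obtain s where "b < ereal s"
        using \<open>b \<noteq> \<infinity>\<close> less_PInf_Ex_of_nat[of b] by auto
      then show ?thesis
        by (intro exI[of _ "(w - t * s) / (1 - t)"] exI[of _ s]) (use t in \<open>simp add: MInf\<close>)
    qed (use assms in simp)
    then show ?thesis using le real by blast
  qed (use z in auto)
qed

text \<open>
  The projection of a convex problem onto its parameters is convex: convex combinations of nearly
  optimal points for the parameters \<open>u\<close> and \<open>v\<close> are feasible for the combined parameter, and their
  objective values obey the convexity inequality of \<open>f\<close>.
\<close>

lemma ereal_convex_on_value_fun: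
  fixes f :: "'m::real_vector \<times> 'n::real_vector \<Rightarrow> ereal"
  assumes f: "ereal_convex_on S f"
  shows "ereal_convex_on UNIV (value_fun f S)"
  unfolding ereal_convex_on_def
proof (intro conjI ballI allI impI convex_UNIV)
  let ?Q = "value_fun f S"
  have S: "convex S"
    using f unfolding ereal_convex_on_def by blast
  fix u v :: 'n and t :: real
  assume t: "0 \<le> t \<and> t \<le> 1"
  show "?Q ((1 - t) *\<^sub>R u + t *\<^sub>R v) \<le> ereal (1 - t) * ?Q u + ereal t * ?Q v"
  proof (cases "t = 0 \<or> t = 1")
    case True
    then show ?thesis by (auto simp flip: zero_ereal_def one_ereal_def)
  next
    case False
    with t have t': "0 < t" "t < 1" by auto
    show ?thesis
    proof (cases "?Q u = \<infinity> \<or> ?Q v = \<infinity>")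
      case True
      then have infinite: "ereal (1 - t) * ?Q u + ereal t * ?Q v = \<infinity>"
        using t' by auto
      show ?thesis unfolding infinite by simp
    next
      case False
      show ?thesis
      proof (rule ereal_le_convex_combinationI[OF _ _ t'])
        fix r s assume r: "?Q u < ereal r" and s: "?Q v < ereal s"
        obtain y y' where y: "(y, u) \<in> S" "f (y, u) < ereal r"
          and y': "(y', v) \<in> S" "f (y', v) < ereal s"
          using r s unfolding value_fun_def INF_less_iff by blast
        let ?w = "(1 - t) *\<^sub>R (y, u) + t *\<^sub>R (y', v)"
        have "?w \<in> S"
          using S y y' t unfolding convex_alt by blast
        then have "?Q ((1 - t) *\<^sub>R u + t *\<^sub>R v) \<le> f ?w"
          unfolding value_fun_def by (intro INF_lower2[of "(1 - t) *\<^sub>R y + t *\<^sub>R y'"]) auto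
        also have "\<dots> \<le> ereal (1 - t) * f (y, u) + ereal t * f (y', v)"
          using f y y' t unfolding ereal_convex_on_def by blast
        also have "\<dots> \<le> ereal (1 - t) * ereal r + ereal t * ereal s"
          using y y' t by (intro add_mono ereal_mult_left_mono) auto
        finally show "?Q ((1 - t) *\<^sub>R u + t *\<^sub>R v) \<le> ereal ((1 - t) * r + t * s)"
          by simp
      qed (use False in auto)
    qed
  qed
qed

text \<open>
  For \<open>x = x\<^sub>0\<close> this is weak duality; for general \<open>x\<close> it says that the dual function produces
  affine minorants of the value function.
\<close>

lemma dual_fun_minorant:
  fixes f :: "'m \<times> 'n::real_inner \<Rightarrow> ereal"
  shows "dual_fun f S x\<^sub>0 lam + ereal (lam \<bullet> (x - x\<^sub>0)) \<le> value_fun f S x"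
  unfolding value_fun_def
proof (rule INF_greatest)
  fix y assume "y \<in> {y. (y, x) \<in> S}"
  then have "dual_fun f S x\<^sub>0 lam \<le> f (y, x) + ereal (lam \<bullet> (x\<^sub>0 - x))"
    unfolding dual_fun_def by (intro INF_lower2[of "(y, x)"]) auto
  then have "dual_fun f S x\<^sub>0 lam + ereal (lam \<bullet> (x - x\<^sub>0))
      \<le> f (y, x) + ereal (lam \<bullet> (x\<^sub>0 - x)) + ereal (lam \<bullet> (x - x\<^sub>0))"
    by (rule add_right_mono)
  also have "\<dots> = f (y, x)"
    by (simp add: add.assoc flip: inner_add_right)
  finally show "dual_fun f S x\<^sub>0 lam + ereal (lam \<bullet> (x - x\<^sub>0)) \<le> f (y, x)" .
qed

lemma value_fun_le_dual_fun_if_subgradient: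
  fixes f :: "'m \<times> 'n::real_inner \<Rightarrow> ereal"
  assumes sub: "\<And>z. value_fun f S x + ereal (v \<bullet> (z - x)) \<le> value_fun f S z"
  shows "value_fun f S x \<le> dual_fun f S x v"
  unfolding dual_fun_def
proof (rule INF_greatest, clarify)
  fix y z assume yz: "(y, z) \<in> S"
  have "value_fun f S x + ereal (v \<bullet> (z - x)) \<le> f (y, z)"
    using sub[of z] yz unfolding value_fun_def by (auto intro: order_trans INF_lower)
  then have "value_fun f S x + ereal (v \<bullet> (z - x)) + ereal (v \<bullet> (x - z))
      \<le> f (y, z) + ereal (v \<bullet> (x - z))"
    by (rule add_right_mono)
  then show "value_fun f S x \<le> f (y, z) + ereal (v \<bullet> (x - z))"
    by (simp add: add.assoc flip: inner_add_right)
qed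

text \<open>
  A subgradient of the value function at \<open>x\<close> is a multiplier that closes the duality gap there; the
  relative interior hypothesis provides one.
\<close>

theorem strong_duality_rel_interior:
  fixes f :: "'m::real_vector \<times> 'n::euclidean_space \<Rightarrow> ereal"
  assumes "ereal_convex_on UNIV (value_fun f S)"
    and "x \<in> rel_interior (ereal_dom (value_fun f S))"
    and "\<bar>value_fun f S x\<bar> \<noteq> \<infinity>"
  shows "dual_value f S x = value_fun f S x"
proof (rule antisym)
  show "dual_value f S x \<le> value_fun f S x"
    unfolding dual_value_def
  proof (rule SUP_least)
    fix lam
    show "dual_fun f S x lam \<le> value_fun f S x"
      using dual_fun_minorant[of f S x lam x] by simp
  qed
  obtain v where "\<And>z. value_fun f S x + ereal (v \<bullet> (z - x)) \<le> value_fun f S z"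
    using ereal_convex_subgradient_exists[OF assms] by blast
  then have "value_fun f S x \<le> dual_fun f S x v"
    by (rule value_fun_le_dual_fun_if_subgradient)
  then show "value_fun f S x \<le> dual_value f S x"
    unfolding dual_value_def by (rule SUP_upper2[OF UNIV_I])
qed

section \<open>Cuts from approximate primal and dual solutions\<close>

lemma approx_value_finite:
  assumes "approx_value v opt"
  shows "\<bar>v\<bar> \<noteq> \<infinity>" "\<bar>opt\<bar> \<noteq> \<infinity>"
  using assms unfolding approx_value_def by (cases v; cases opt; auto)+

theorem corollary2p4:
  fixes X :: "(real^'n) set" and Y :: "(real^'m) set"
    and f :: "(real^'m) \<times> (real^'n) \<Rightarrow> ereal"
    and p :: nat and g :: "nat \<Rightarrow> (real^'m) \<times> (real^'n) \<Rightarrow> ereal"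
    and A :: "real^'m^'q" and B :: "real^'n^'q" and b :: "real^'q"
    and xbar lamhat :: "real^'n" and yhat :: "real^'m"
  defines "S \<equiv> constraint_set Y p g A B b"
  defines "Q \<equiv> value_fun f S"
  defines "\<theta> \<equiv> dual_fun f S xbar"
  defines "C \<equiv> dual_cut f S xbar lamhat"
  assumes X: "convex X" "closed X" "X \<noteq> {}"
    and Y: "convex Y" "closed Y" "Y \<noteq> {}"
    and f: "ereal_proper f" "ereal_lsc f" "ereal_convex_on UNIV f"
    and g: "\<And>i. i \<in> {1..p} \<Longrightarrow> ereal_proper (g i) \<and> ereal_lsc (g i) \<and> ereal_convex_on UNIV (g i)"
    and xbar: "xbar \<in> X"
    and finite_slice: "\<And>y. (y, xbar) \<in> S \<Longrightarrow> \<bar>f (y, xbar)\<bar> \<noteq> \<infinity>"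
    and slater: "\<exists>y. (y, xbar) \<in> rel_interior S"
    and yhat: "approx_primal_sol f S xbar yhat"
    and lamhat: "approx_dual_sol f S xbar lamhat"
  shows "\<bar>\<theta> lamhat\<bar> \<noteq> \<infinity> \<and>
    cut_conditions X Q C xbar (real_of_ereal (f (yhat, xbar) - \<theta> lamhat)) \<and>
    (X \<subseteq> rel_interior (ereal_dom Q) \<longrightarrow>
       inexact_cut X Q C xbar (real_of_ereal (f (yhat, xbar) - \<theta> lamhat)) \<and>
       (optimal_primal_sol f S xbar yhat \<and> optimal_dual_sol f S xbar lamhat \<longrightarrow>
          f (yhat, xbar) = \<theta> lamhat \<and> \<theta> lamhat = Q xbar \<and> exact_cut X Q C xbar))"
proof -
  have \<theta>_fin: "\<bar>\<theta> lamhat\<bar> \<noteq> \<infinity>"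
    using approx_value_finite(1) lamhat unfolding approx_dual_sol_def \<theta>_def by metis
  then obtain d where d: "\<theta> lamhat = ereal d" by auto
  have "\<bar>f (yhat, xbar)\<bar> \<noteq> \<infinity>"
    using approx_value_finite(1) yhat unfolding approx_primal_sol_def by metis
  then obtain c where c: "f (yhat, xbar) = ereal c" by auto
  have C: "C x = d + lamhat \<bullet> (x - xbar)" for x
    using d by (simp add: C_def dual_cut_def \<theta>_def)
  have minorant: "ereal (C x) \<le> Q x" for x
    using dual_fun_minorant[of f S xbar lamhat x] d by (simp add: C Q_def \<theta>_def)
  have Q_le: "Q xbar \<le> ereal c"
    using yhat c unfolding Q_def value_fun_def approx_primal_sol_def by (auto intro: INF_lower2)
  let ?\<epsilon> = "real_of_ereal (f (yhat, xbar) - \<theta> lamhat)"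
  have \<epsilon>: "?\<epsilon> = c - d" by (simp add: c d)
  have "ereal d \<le> ereal c"
    using order_trans[OF minorant Q_le] by (simp add: C)
  moreover have "affine_fun_on X C"
    unfolding affine_fun_on_def
  proof (intro exI conjI ballI)
    show "linear (\<lambda>x. lamhat \<bullet> x)"
      by (rule bounded_linear.linear[OF bounded_linear_inner_right])
    show "C x = lamhat \<bullet> x + (d - lamhat \<bullet> xbar)" for x
      by (simp add: C inner_diff_right)
  qed
  moreover have "Q xbar - ereal (C xbar) \<le> ereal (c - d)"
    using ereal_minus_mono[OF Q_le order_refl, of "ereal d"] by (simp add: C)
  ultimately have conds: "cut_conditions X Q C xbar ?\<epsilon>"
    unfolding cut_conditions_def \<epsilon> using xbar minorant by simp
  have "inexact_cut X Q C xbar ?\<epsilon> \<and>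
     (optimal_primal_sol f S xbar yhat \<and> optimal_dual_sol f S xbar lamhat \<longrightarrow>
        f (yhat, xbar) = \<theta> lamhat \<and> \<theta> lamhat = Q xbar \<and> exact_cut X Q C xbar)"
    if dom: "X \<subseteq> rel_interior (ereal_dom Q)"
  proof -
    have "convex S"
      unfolding S_def using Y(1) g by (intro convex_constraint_set) auto
    then have "ereal_convex_on S f"
      by (rule ereal_convex_on_subset[OF f(3) subset_UNIV])
    then have Q_convex: "ereal_convex_on UNIV Q"
      unfolding Q_def by (rule ereal_convex_on_value_fun)
    have Q_fin: "\<bar>Q x\<bar> \<noteq> \<infinity>" if "x \<in> X" for x
      using that dom rel_interior_subset[of "ereal_dom Q"] minorant[of x]
      by (auto simp: ereal_dom_def)
    have "ereal_convex_on X Q"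
      by (rule ereal_convex_on_subset[OF Q_convex subset_UNIV X(1)])
    then have cut: "inexact_cut X Q C xbar ?\<epsilon>"
      unfolding inexact_cut_def cut_setting_def
      using conds X(1) Q_fin dom by (intro conjI ballI)
    moreover have "f (yhat, xbar) = \<theta> lamhat \<and> \<theta> lamhat = Q xbar \<and> exact_cut X Q C xbar"
      if primal: "optimal_primal_sol f S xbar yhat" and dual: "optimal_dual_sol f S xbar lamhat"
    proof -
      have "dual_value f S xbar = Q xbar"
        using strong_duality_rel_interior[of f S xbar] Q_convex Q_fin[OF xbar] subsetD[OF dom xbar]
        unfolding Q_def by simp
      then have eq: "\<theta> lamhat = Q xbar" "f (yhat, xbar) = \<theta> lamhat"
        using primal dual
        by (simp_all add: optimal_primal_sol_def optimal_dual_sol_def \<theta>_def Q_def)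
      then have "?\<epsilon> = 0" by (simp add: d)
      with cut eq show ?thesis unfolding exact_cut_def by simp
    qed
    ultimately show ?thesis by blast
  qed
  with \<theta>_fin conds show ?thesis by blast
qed

end
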